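(* Let $n>2$ be an integer. Then: (1) if there exists an admissible graph of order $n$ with $e$ edges, then every vertex of such a graph has degree at least $e-g(n-1)$; (2) $g(n)\le \left\lfloor \dfrac{n\, g(n-1)}{n-2}\right\rfloor$.
   Context: A finite simple graph is admissible if its vertices can be labeled with pairwise distinct integers such that for every edge the sum of the labels of its two endpoints is a power of $2$ (an integer $2^k$ with $k\ge0$). For a positive integer $m$, $g(m)$ is the maximum number of edges of an admissible graph on $m$ vertices; equivalently, the maximum over $m$-element sets $A\subset\mathbb{Z}$ of the number of $2$-element subsets of $A$ whose sum is a power of $2$. *)

theory Defs
  imports Complex_Main
begin

definition simple_graph :: "'a set \<Rightarrow> 'a set set \<Rightarrow> bool" where
  "simple_graph V E \<longleftrightarrow> finite V \<and> (\<forall>e\<in>E. e \<subseteq> V \<and> card e = 2)"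

definition degree :: "'a set set \<Rightarrow> 'a \<Rightarrow> nat" where
  "degree E v = card {e \<in> E. v \<in> e}"

definition admissible :: "'a set \<Rightarrow> 'a set set \<Rightarrow> bool" where
  "admissible V E \<longleftrightarrow> simple_graph V E \<and>
     (\<exists>f :: 'a \<Rightarrow> int. inj_on f V \<and>
        (\<forall>u v. {u, v} \<in> E \<longrightarrow> (\<exists>k :: nat. f u + f v = 2 ^ k)))"

text \<open>
  In the maximum the vertices are natural numbers, since the vertex type has to be fixed. This is
  no restriction: every finite graph is isomorphic to one on natural numbers, and
  \<open>card_edges_le_g\<close> below shows that the bound holds for every vertex type.
\<close>

definition g :: "nat \<Rightarrow> nat" where
  "g m = Max {card E | (V :: nat set) E. admissible V E \<and> card V = m}"

text \<open>The maximum is over a finite nonempty set.\<close>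

lemma g_set_finite: "finite {card E | (V :: nat set) E. admissible V E \<and> card V = m}"
proof (rule finite_subset)
  show "{card E | (V :: nat set) E. admissible V E \<and> card V = m} \<subseteq> {..2 ^ m}"
  proof clarify
    fix V :: "nat set" and E assume "admissible V E"
    then have "finite V" "E \<subseteq> Pow V"
      by (auto simp: admissible_def simple_graph_def)
    then have "card E \<le> card (Pow V)"
      by (intro card_mono) auto
    then show "card E \<le> 2 ^ card V"
      using \<open>finite V\<close> by (simp add: card_Pow)
  qed
qed simp

lemma g_set_nonempty: "{card E | (V :: nat set) E. admissible V E \<and> card V = m} \<noteq> {}"
proof -
  have "admissible {..<m} ({} :: nat set set)"
    by (auto simp: admissible_def simple_graph_def intro!: exI[of _ int] inj_onI)
  then show ?thesis
    by (auto intro!: exI[of _ "{..<m}"])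
qed

lemma card_edges_le_g:
  fixes V :: "'a set"
  assumes "admissible V E"
  shows "card E \<le> g (card V)"
proof -
  from assms obtain f :: "'a \<Rightarrow> int"
    where V: "finite V" and E: "\<And>e. e \<in> E \<Longrightarrow> e \<subseteq> V \<and> card e = 2"
      and f: "inj_on f V" "\<And>u v. {u, v} \<in> E \<Longrightarrow> \<exists>k :: nat. f u + f v = 2 ^ k"
    unfolding admissible_def simple_graph_def by metis
  obtain h :: "'a \<Rightarrow> nat" where h: "inj_on h V"
    using V finite_imp_inj_to_nat_seg by metis
  define h' where "h' = inv_into V h"
  have h': "h' (h x) = x" if "x \<in> V" for x
    using that h by (simp add: h'_def)
  have pre: "h' ` h ` e = e" if "e \<in> E" for e
    using E[OF that] h' by (auto simp: image_iff subset_iff)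
  have injE: "inj_on ((`) h) E"
    by (rule inj_on_inverseI[where g = "(`) h'"]) (use pre in simp)
  have lab: "\<exists>k :: nat. f (h' u) + f (h' v) = 2 ^ k" if "{u, v} \<in> (`) h ` E" for u v
  proof -
    from that obtain e where e: "e \<in> E" "{u, v} = h ` e" by auto
    then have "{h' u, h' v} = h' ` h ` e" by (metis image_empty image_insert)
    with pre[OF e(1)] e(1) have "{h' u, h' v} \<in> E" by simp
    then show ?thesis by (rule f(2))
  qed
  have "card (h ` e) = 2" if "e \<in> E" for e
    using E[OF that] h by (metis card_image inj_on_subset)
  then have "simple_graph (h ` V) ((`) h ` E)"
    using V E by (auto simp: simple_graph_def)
  moreover have "inj_on (f \<circ> h') (h ` V)"
    using f(1) h' by (auto simp: inj_on_def)
  ultimately have "admissible (h ` V) ((`) h ` E)"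
    unfolding admissible_def using lab by (intro conjI exI[of _ "f \<circ> h'"]) auto
  moreover have "card (h ` V) = card V" "card ((`) h ` E) = card E"
    using h injE by (auto simp: card_image)
  ultimately have "card E \<in> {card E | (V' :: nat set) E. admissible V' E \<and> card V' = card V}"
    by (metis (mono_tags, lifting) mem_Collect_eq)
  then show ?thesis
    unfolding g_def by (rule Max_ge[OF g_set_finite])
qed

end

theory Submission
  imports Defs
begin

text \<open>
  Deleting a vertex \<open>v\<close> leaves an admissible graph of order \<open>n - 1\<close> with \<open>e - degree E v\<close> edges,
  which gives the degree bound. Summing it over all vertices of an extremal graph, where the
  degrees add up to \<open>2 e\<close>, yields \<open>n (e - g (n - 1)) \<le> 2 e\<close>.
\<close>

lemma simple_graph_finite_edges:
  assumes "simple_graph V E"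
  shows "finite E"
proof (rule finite_subset)
  show "E \<subseteq> Pow V" "finite (Pow V)"
    using assms by (auto simp: simple_graph_def)
qed

text \<open>Handshake lemma, by double counting the pairs of a vertex and an edge containing
  it.\<close>

lemma sum_degree:
  assumes "simple_graph V E"
  shows "(\<Sum>v\<in>V. degree E v) = 2 * card E"
  unfolding degree_def
proof (rule sum_multicount)
  show "finite V" "finite E"
    using assms simple_graph_finite_edges by (auto simp: simple_graph_def)
  \<comment> \<open>Edges lie inside \<open>V\<close>, so restricting to \<open>V\<close> loses no
    endpoint and each edge is counted exactly twice.\<close>
  have "{v \<in> V. v \<in> e} = e" if "e \<in> E" for e
    using assms that by (auto simp: simple_graph_def)
  then show "\<forall>e\<in>E. card {v \<in> V. v \<in> e} = 2"
    using assms by (simp add: simple_graph_def)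
qed

text \<open>The old labeling still works: it stays injective on fewer vertices, and every surviving
  edge was already an edge.\<close>

lemma admissible_delete_vertex:
  assumes "admissible V E"
  shows "admissible (V - {v}) {e \<in> E. v \<notin> e}"
proof -
  from assms obtain f :: "'a \<Rightarrow> int" where "simple_graph V E" "inj_on f V"
    and "\<forall>u v. {u, v} \<in> E \<longrightarrow> (\<exists>k :: nat. f u + f v = 2 ^ k)"
    unfolding admissible_def by blast
  moreover from this have "inj_on f (V - {v})"
    by (auto intro: inj_on_subset)
  ultimately show ?thesis
    unfolding admissible_def simple_graph_def by (intro conjI exI[of _ f]) auto
qed

text \<open>The edges split into those through \<open>v\<close>, counted by the degree, and those of
  the graph with \<open>v\<close> deleted. The additive form avoids truncated subtraction on
  \<open>nat\<close>.\<close>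

lemma card_edges_le_degree_plus_g:
  assumes "admissible V E" "v \<in> V"
  shows "card E \<le> degree E v + g (card V - 1)"
proof -
  have "simple_graph V E"
    using assms(1) by (simp add: admissible_def)
  then have "finite E" "finite V"
    using simple_graph_finite_edges by (auto simp: simple_graph_def)
  have "card E = card ({e \<in> E. v \<in> e} \<union> {e \<in> E. v \<notin> e})"
    by (rule arg_cong[where f = card]) blast
  also have "\<dots> = degree E v + card {e \<in> E. v \<notin> e}"
    unfolding degree_def using \<open>finite E\<close> by (intro card_Un_disjoint) auto
  also have "card {e \<in> E. v \<notin> e} \<le> g (card (V - {v}))"
    by (rule card_edges_le_g[OF admissible_delete_vertex[OF assms(1)]])
  finally show ?thesis
    using assms(2) \<open>finite V\<close> by simp
qed

lemma g_attained:
  obtains V :: "nat set" and E where "admissible V E" "card V = m" "card E = g m"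
proof -
  have "g m \<in> {card E | (V :: nat set) E. admissible V E \<and> card V = m}"
    unfolding g_def by (rule Max_in[OF g_set_finite g_set_nonempty])
  then show ?thesis
    using that by auto
qed

lemma g_recurrence: "n * g n \<le> 2 * g n + n * g (n - 1)"
proof -
  obtain V :: "nat set" and E where VE: "admissible V E" "card V = n" "card E = g n"
    by (rule g_attained)
  have "n * g n = (\<Sum>v\<in>V. card E)"
    using VE by simp
  also have "\<dots> \<le> (\<Sum>v\<in>V. degree E v + g (n - 1))"
    using card_edges_le_degree_plus_g[OF VE(1)] VE(2) by (intro sum_mono) auto
  also have "\<dots> = 2 * g n + n * g (n - 1)"
    using VE sum_degree[of V E] by (simp add: sum.distrib admissible_def)
  finally show ?thesis .
qed

theorem theorem3:
  fixes n :: nat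
  assumes "n > 2"
  shows "(\<forall>(V :: 'a set) E e. admissible V E \<and> card V = n \<and> card E = e \<longrightarrow>
            (\<forall>v\<in>V. int (degree E v) \<ge> int e - int (g (n - 1)))) \<and>
         int (g n) \<le> \<lfloor>real n * real (g (n - 1)) / (real n - 2)\<rfloor>"
proof (intro conjI allI impI ballI)
  fix V :: "'a set" and E e v
  assume "admissible V E \<and> card V = n \<and> card E = e" "v \<in> V"
  then show "int (degree E v) \<ge> int e - int (g (n - 1))"
    using card_edges_le_degree_plus_g[of V E v] by auto
next
  have "real (n * g n) \<le> real (2 * g n + n * g (n - 1))"
    using g_recurrence of_nat_le_iff by blast
  \<comment> \<open>Over the reals \<open>2 * g n\<close> can be moved to the left;
    \<open>n > 2\<close> then allows division by \<open>real n - 2\<close>, and the floor may be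
    taken because \<open>g n\<close> is an integer.\<close>
  then have "real (g n) * (real n - 2) \<le> real n * real (g (n - 1))"
    by (simp add: algebra_simps)
  then show "int (g n) \<le> \<lfloor>real n * real (g (n - 1)) / (real n - 2)\<rfloor>"
    using assms by (simp add: le_floor_iff pos_le_divide_eq)
qed

end
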